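(* Let $n,d>1$ be integers. Set $X=\{jd : 0\le j\le n\}$, $m=(4n+1)d+1$, $Y=m-X=\{m-x: x\in X\}$, $Z=\{z\in\mathbb{Z} : 2nd<z\le (2n+1)d\}$, $B=X\sqcup Y\sqcup Z$, $a=2nd$, and $A=B\sqcup\{a\}$. Then $A$ is a normalised set with $|A+A|=|A-A|+1$ (in particular $|A+A|>|A-A|$).
   Context: For $A\subseteq\mathbb{Z}$, $A+A=\{a_1+a_2 : a_1,a_2\in A\}$ and $A-A=\{a_1-a_2 : a_1,a_2\in A\}$. A finite set $A\subseteq\mathbb{Z}$ is normalised if its smallest element is $0$ and the greatest common divisor of its elements is $1$. *)

theory Defs
  imports Complex_Main "HOL-Library.Set_Algebras"
begin

(* The sumset is the library's operation + on sets from Set_Algebras.  The operation - on sets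
   is set-theoretic difference, so the difference set needs a separate name. *)
definition difference_set :: "int set \<Rightarrow> int set \<Rightarrow> int set" where
  "difference_set A B = {a - b | a b. a \<in> A \<and> b \<in> B}"

(* Nonemptiness is explicit because Min {} is an unspecified value. *)
definition normalised :: "int set \<Rightarrow> bool" where
  "normalised A \<longleftrightarrow> finite A \<and> A \<noteq> {} \<and> Min A = 0 \<and> Gcd A = 1"

end

(* B is symmetric about m / 2, so B + B is a translate of B - B and has the same size.  Adjoining a
   creates no new difference, while a + a is the only new sum. *)
theory Submission
  imports Defs
begin

text \<open>The reflection b -> m - b swaps \<open>X\<close> and \<open>Y\<close> and, because m =
  2a + d + 1, reverses the interval \<open>Z\<close> = {a+1, ..., a+d}; hence |B + B| = |B - B| by
  \<open>card_difference_set_symmetric\<close>. The point \<open>a\<close> sits just below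
  \<open>Z\<close>, so a + b can be rewritten inside \<open>B\<close>: replace \<open>a\<close> by
  an end of \<open>Z\<close> (a + d or a + 1) and move b one step back in its block. Where b starts
  its block, a = nd + nd or 2a + 1 = m - d helps instead. Reflected, the same rewriting handles a -
  b, so \<open>difference_set_insert\<close> and \<open>set_plus_insert_self\<close> leave only a +
  a in doubt. That sum is new: 2a = m - d - 1 is too large for X + X and X + Z, too small for a sum
  of two elements of Y and Z, and in the wrong class modulo d for X + Y, whose elements are all
  congruent to m.\<close>

lemma card_difference_set_symmetric:
  fixes m :: int
  assumes "(\<lambda>b. m - b) ` B = B"
  shows "card (difference_set B B) = card (B + B)"
proof -
  have refl: "m - b \<in> B" if "b \<in> B" for b
    using assms that by blast
  have "difference_set B B = (\<lambda>s. s - m) ` (B + B)"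
  proof (intro equalityI subsetI)
    fix t assume "t \<in> difference_set B B"
    then obtain x y where "x \<in> B" "y \<in> B" "t = x - y"
      unfolding difference_set_def by blast
    then have "x + (m - y) \<in> B + B" "t = x + (m - y) - m"
      using refl by auto
    then show "t \<in> (\<lambda>s. s - m) ` (B + B)" by blast
  next
    fix t assume "t \<in> (\<lambda>s. s - m) ` (B + B)"
    then obtain x y where "x \<in> B" "y \<in> B" "t = x - (m - y)"
      by (auto elim!: set_plus_elim)
    then show "t \<in> difference_set B B"
      unfolding difference_set_def using refl by blast
  qed
  then show ?thesis by (simp add: card_image inj_on_def)
qed

text \<open>A difference set is closed under negation, so controlling a - b also controls b - a; the
  remaining difference a - a is 0, already present since \<open>B\<close> is nonempty.\<close>

lemma difference_set_insert:
  assumes "B \<noteq> {}" and "\<And>b. b \<in> B \<Longrightarrow> a - b \<in> difference_set B B"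
  shows "difference_set (insert a B) (insert a B) = difference_set B B"
proof -
  have swap: "- t \<in> difference_set B B" if "t \<in> difference_set B B" for t
    using that unfolding difference_set_def by force
  have "b - a \<in> difference_set B B" if "b \<in> B" for b
    using swap[OF assms(2)[OF that]] by simp
  moreover have "0 \<in> difference_set B B"
    using assms(1) unfolding difference_set_def by force
  ultimately have "difference_set (insert a B) (insert a B) \<subseteq> difference_set B B"
    using assms(2) by (auto simp: difference_set_def[of "insert a B"] difference_set_def[of B B])
  moreover have "difference_set B B \<subseteq> difference_set (insert a B) (insert a B)"
    unfolding difference_set_def by blast
  ultimately show ?thesis by blast
qed

text \<open>Isolates a + a as the one sum about which nothing is assumed: the sumset grows by one
  exactly when a + a is not in B + B.\<close>

lemma set_plus_insert_self:
  fixes a :: "'a :: comm_monoid_add"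
  assumes "\<And>b. b \<in> B \<Longrightarrow> a + b \<in> B + B"
  shows "insert a B + insert a B = insert (a + a) (B + B)"
proof (intro equalityI subsetI)
  fix t assume "t \<in> insert a B + insert a B"
  then obtain x y where "x \<in> insert a B" "y \<in> insert a B" "t = x + y"
    by (rule set_plus_elim)
  then show "t \<in> insert (a + a) (B + B)"
    using assms by (metis insert_iff add.commute set_plus_intro)
next
  fix t assume "t \<in> insert (a + a) (B + B)"
  then show "t \<in> insert a B + insert a B"
    by (elim insertE set_plus_elim) auto
qed

theorem theorem4:
  fixes n d m a :: int and X Y Z B A :: "int set"
  assumes "n > 1" and "d > 1"
    and "X = {j * d | j. 0 \<le> j \<and> j \<le> n}"
    and "m = (4 * n + 1) * d + 1"
    and "Y = {m - x | x. x \<in> X}"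
    and "Z = {z. 2 * n * d < z \<and> z \<le> (2 * n + 1) * d}"
    and "B = X \<union> Y \<union> Z"
    and "a = 2 * n * d"
    and "A = B \<union> {a}"
  shows "X \<inter> Y = {} \<and> (X \<union> Y) \<inter> Z = {} \<and> a \<notin> B
    \<and> normalised A
    \<and> card (A + A) = card (difference_set A A) + 1
    \<and> card (A + A) > card (difference_set A A)"
proof -
  \<comment> \<open>Coordinates on the three blocks; \<open>Z\<close> is measured by its offset from
    \<open>a\<close>, so that shifts of b become shifts of an index.\<close>
  have memX: "j * d \<in> B" if "0 \<le> j" "j \<le> n" for j
    using that assms(3,7) by auto
  have memY: "m - j * d \<in> B" if "0 \<le> j" "j \<le> n" for j
    using that assms(3,5,7) by auto
  have memZ: "a + i \<in> B" if "0 < i" "i \<le> d" for i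
    using that assms(6,7,8) by (auto simp: algebra_simps)
  have casesB: "(\<exists>j. 0 \<le> j \<and> j \<le> n \<and> b = j * d)
      \<or> (\<exists>j. 0 \<le> j \<and> j \<le> n \<and> b = m - j * d)
      \<or> (\<exists>i. 0 < i \<and> i \<le> d \<and> b = a + i)" if "b \<in> B" for b
  proof -
    consider "b \<in> X" | "b \<in> Y" | "b \<in> Z" using \<open>b \<in> B\<close> assms(7) by blast
    then show ?thesis
    proof cases
      case 3
      then have "0 < b - a \<and> b - a \<le> d \<and> b = a + (b - a)"
        using assms(6,8) by (simp add: algebra_simps)
      then show ?thesis by blast
    qed (use assms(3,5) in blast)+
  qed
  have m_eq: "m = 2 * a + d + 1" using assms(4,8) by (simp add: algebra_simps)
  have a_eq: "a = 2 * (n * d)" using assms(8) by simp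
  have nd: "2 * d \<le> n * d" using assms(1,2) by (intro mult_right_mono) auto
  have jd: "0 \<le> j * d \<and> j * d \<le> n * d" if "0 \<le> j" "j \<le> n" for j
    using that assms(2) by (auto intro: mult_right_mono)

  have boundX: "0 \<le> x \<and> x \<le> n * d" if "x \<in> X" for x
    using that jd assms(3) by auto
  have boundY: "m - n * d \<le> y \<and> y \<le> m" if "y \<in> Y" for y
    using that boundX assms(5) by auto
  have boundZ: "a < z \<and> z \<le> a + d" if "z \<in> Z" for z
    using that assms(6,8) by (simp add: algebra_simps)
  \<comment> \<open>The blocks lie on the line in the order X < a < Z < Y.\<close>
  have gaps: "0 < n * d" "n * d < a" "a + d < m - n * d"
    using m_eq a_eq nd assms(2) by linarith+
  have "x \<noteq> y" if "x \<in> X" "y \<in> Y" for x y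
    using boundX[OF that(1)] boundY[OF that(2)] gaps assms(2) by linarith
  then have XY: "X \<inter> Y = {}" by blast
  have "x \<noteq> z" if "x \<in> X" "z \<in> Z" for x z
    using boundX[OF that(1)] boundZ[OF that(2)] gaps by linarith
  moreover have "y \<noteq> z" if "y \<in> Y" "z \<in> Z" for y z
    using boundY[OF that(1)] boundZ[OF that(2)] gaps by linarith
  ultimately have XYZ: "(X \<union> Y) \<inter> Z = {}" by blast
  have "a \<notin> X" "a \<notin> Y" "a \<notin> Z"
    using boundX[of a] boundY[of a] boundZ[of a] gaps assms(2) by linarith+
  then have aB: "a \<notin> B" using assms(7) by blast

  have A_eq: "A = insert a B" using assms(9) by blast
  have "X = (\<lambda>j. j * d) ` {0..n}" using assms(3) by auto
  then have "finite X" by simp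
  moreover have "Y = (\<lambda>x. m - x) ` X" using assms(5) by auto
  moreover have "Z = {a<..(2 * n + 1) * d}" using assms(6,8) by auto
  ultimately have finB: "finite B" using assms(7) by simp
  have B0: "0 \<in> B" using memX[of 0] assms(1) by simp
  have Bd: "d \<in> B" using memX[of 1] assms(1) by simp
  have Bnd: "n * d \<in> B" using memX[of n] assms(1) by simp
  have Bmnd: "m - n * d \<in> B" using memY[of n] assms(1) by simp
  have Ba1: "a + 1 \<in> B" using memZ[of 1] assms(2) by simp
  have Bad: "a + d \<in> B" using memZ[of d] assms(2) by simp
  have Bm: "m \<in> B" using memY[of 0] assms(1) by simp

  have nonneg: "0 \<le> x" if "x \<in> A" for x
  proof -
    consider "x = a" | "x \<in> X" | "x \<in> Y" | "x \<in> Z" using \<open>x \<in> A\<close> A_eq assms(7) by blast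
    then show ?thesis
      using boundX[of x] boundY[of x] boundZ[of x] gaps assms(2) by cases linarith+
  qed
  have "Min A = 0"
    using finB B0 A_eq nonneg by (intro Min_eqI) auto
  moreover have "Gcd A = 1"
  proof -
    \<comment> \<open>\<open>A\<close> contains \<open>d\<close> and \<open>m\<close>, and m is 1
      modulo d.\<close>
    have "Gcd A dvd d" "Gcd A dvd m"
      using Bd Bm A_eq by (intro Gcd_dvd; blast)+
    moreover have "m - (4 * n + 1) * d = 1" using assms(4) by simp
    ultimately have "Gcd A dvd 1" by (metis dvd_diff dvd_mult)
    then show ?thesis using Gcd_int_greater_eq_0[of A] by simp
  qed
  ultimately have norm: "normalised A"
    using finB B0 A_eq unfolding normalised_def by blast

  have refl: "m - b \<in> B" if "b \<in> B" for b
    using casesB[OF that]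
  proof (elim disjE exE conjE)
    fix i assume "0 < i" "i \<le> d" "b = a + i"
    \<comment> \<open>m - (a + i) = a + (d + 1 - i), and d + 1 - i runs through 1, ..., d as i
      does.\<close>
    then show ?thesis using memZ[of "d + 1 - i"] m_eq by (simp add: algebra_simps)
  qed (use memX memY in auto)
  have sym: "(\<lambda>b. m - b) ` B = B"
  proof
    show "B \<subseteq> (\<lambda>b. m - b) ` B"
    proof
      fix b assume "b \<in> B"
      then show "b \<in> (\<lambda>b. m - b) ` B"
        using refl[of b] by (intro image_eqI[of _ _ "m - b"]) auto
    qed
  qed (use refl in auto)

  \<comment> \<open>In each block the generic case steps b back by d (or by 1 in \<open>Z\<close>)
    and compensates with a + d (or a + 1); the least element of the block is treated
    separately.\<close>
  have sum: "a + b \<in> B + B" if "b \<in> B" for b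
    using casesB[OF that]
  proof (elim disjE exE conjE)
    fix j assume j: "0 \<le> j" "j \<le> n" "b = j * d"
    show ?thesis
    proof (cases "j = 0")
      case True
      then have "a + b = n * d + n * d" using j a_eq by simp
      then show ?thesis using Bnd by (metis set_plus_intro)
    next
      case False
      then have "a + b = (a + d) + (j - 1) * d" using j by (simp add: algebra_simps)
      moreover have "(j - 1) * d \<in> B" using False j by (intro memX) auto
      ultimately show ?thesis using Bad by (metis set_plus_intro)
    qed
  next
    fix j assume j: "0 \<le> j" "j \<le> n" "b = m - j * d"
    show ?thesis
    proof (cases "j = n")
      case True
      then have "a + b = n * d + m" using j a_eq by simp
      then show ?thesis using Bnd Bm by (metis set_plus_intro)
    next
      case False
      then have "a + b = (a + d) + (m - (j + 1) * d)" using j by (simp add: algebra_simps)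
      moreover have "m - (j + 1) * d \<in> B" using False j by (intro memY) auto
      ultimately show ?thesis using Bad by (metis set_plus_intro)
    qed
  next
    fix i assume i: "0 < i" "i \<le> d" "b = a + i"
    show ?thesis
    proof (cases "i = 1")
      case True
      \<comment> \<open>Here a + b = 2a + 1, which is the element m - d of \<open>Y\<close>.\<close>
      then have "a + b = 0 + (m - d)" using i m_eq by simp
      then show ?thesis using B0 memY[of 1] assms(1) set_plus_intro[of 0 B "m - d" B] by simp
    next
      case False
      then have "a + b = (a + 1) + (a + (i - 1))" using i by simp
      moreover have "a + (i - 1) \<in> B" using False i by (intro memZ) auto
      ultimately show ?thesis using Ba1 by (metis set_plus_intro)
    qed
  qed

  have diffI: "x - y \<in> difference_set B B" if "x \<in> B" "y \<in> B" for x y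
    using that unfolding difference_set_def by blast
  \<comment> \<open>These are the decompositions of a + (m - b) used for \<open>sum\<close>, shifted
    by -m: a summand s becomes the subtrahend m - s. The exceptional indices are thus the
    reflections of the earlier ones.\<close>
  have diff: "a - b \<in> difference_set B B" if "b \<in> B" for b
    using casesB[OF that]
  proof (elim disjE exE conjE)
    fix j assume j: "0 \<le> j" "j \<le> n" "b = j * d"
    show ?thesis
    proof (cases "j = n")
      case True
      then have "a - b = n * d - 0" using j a_eq by simp
      then show ?thesis using diffI[OF Bnd B0] by simp
    next
      case False
      then have "a - b = (a + d) - (j + 1) * d" using j by (simp add: algebra_simps)
      moreover have "(j + 1) * d \<in> B" using False j by (intro memX) auto
      ultimately show ?thesis using diffI Bad by metis
    qed
  next
    fix j assume j: "0 \<le> j" "j \<le> n" "b = m - j * d"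
    show ?thesis
    proof (cases "j = 0")
      case True
      then have "a - b = n * d - (m - n * d)" using j a_eq by simp
      then show ?thesis using diffI[OF Bnd Bmnd] by simp
    next
      case False
      then have "a - b = (j - 1) * d - (a + 1)" using j m_eq by (simp add: algebra_simps)
      moreover have "(j - 1) * d \<in> B" using False j by (intro memX) auto
      ultimately show ?thesis using diffI Ba1 by metis
    qed
  next
    fix i assume i: "0 < i" "i \<le> d" "b = a + i"
    show ?thesis
    proof (cases "i = d")
      case True
      then have "a - b = 0 - d" using i by simp
      then show ?thesis using diffI[OF B0 Bd] by simp
    next
      case False
      then have "a - b = (a + 1) - (a + (i + 1))" using i by simp
      moreover have "a + (i + 1) \<in> B" using False i by (intro memZ) auto
      ultimately show ?thesis using diffI Ba1 by metis
    qed
  qed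

  have newXY: "a + a \<noteq> x + y" if "x \<in> X" "y \<in> Y" for x y
  proof
    obtain i j where "x = i * d" "y = m - j * d"
      using \<open>x \<in> X\<close> \<open>y \<in> Y\<close> assms(3,5) by auto
    moreover assume "a + a = x + y"
    \<comment> \<open>Compare 2a = m - d - 1 with x + y = m - (j - i)d: modulo d they differ by 1,
      which d > 1 forbids.\<close>
    ultimately have "d * (j - i - 1) = 1" using m_eq by (simp add: algebra_simps)
    then have "d dvd 1" by (metis dvd_triv_left)
    then show False using assms(2) by simp
  qed
  have "a + a \<noteq> x + y" if "x \<in> B" "y \<in> B" for x y
  proof -
    consider "x \<in> X" "y \<in> Y" | "y \<in> X" "x \<in> Y" | "x \<in> X" "y \<in> X \<union> Z" | "x \<in> Z" "y \<in> X"
      | "x \<in> Y \<union> Z" "y \<in> Y \<union> Z"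
      using \<open>x \<in> B\<close> \<open>y \<in> B\<close> assms(7) by blast
    then show ?thesis
    proof cases
      case 1
      then show ?thesis by (rule newXY)
    next
      case 2
      then show ?thesis using newXY[of y x] by simp
    next
      case 3
      then have "x \<le> n * d" "y \<le> a + d"
        using boundX[of x] boundX[of y] boundZ[of y] gaps assms(2) by auto
      \<comment> \<open>The largest such sum is at most nd + a + d < 2a, as a = 2nd and d < nd. This
        is where n > 1 enters; at n = 1 the bound would be an equality.\<close>
      then show ?thesis using a_eq nd assms(2) by linarith
    next
      case 4
      then show ?thesis using boundZ[of x] boundX[of y] a_eq nd assms(2) by linarith
    next
      case 5
      then have "a < x" "a < y"
        using boundY[of x] boundZ[of x] boundY[of y] boundZ[of y] gaps assms(2) by auto
      then show ?thesis by linarith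
    qed
  qed
  then have new: "a + a \<notin> B + B" by (auto elim!: set_plus_elim)

  have "card (A + A) = Suc (card (B + B))"
    using set_plus_insert_self[OF sum] new finB A_eq by (simp add: finite_set_plus)
  also have "card (B + B) = card (difference_set A A)"
    using card_difference_set_symmetric[OF sym] difference_set_insert[OF _ diff] B0 A_eq
    by (metis empty_iff)
  finally show ?thesis using XY XYZ aB norm by simp
qed

end
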